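(* Let $G$ be a $t$-distance-regular graph with vertex set $V$ and adjacency matrix $A$. Let $\mathfrak{X}=(V,\{A_i\}_{i=0}^d)$ be the symmetric association scheme corresponding to the $t$-distance matrices of $G$, and let $p_{ij}^k$ be the intersection numbers of $\mathfrak{X}$. Define the matrix $B=(q_{ij})$, indexed by $\{0,\ldots,d\}$, with entries given by \[ q_{ij}=\sum_{x=1}^{t} p_{ij}^{e_x}, \] where $e_1,\ldots,e_t\in\{0,\ldots,d\}$ satisfy $A=\sum_{x=1}^{t}A_{e_x}$. Then, for any distinct vertices $u$ and $v$ in $G$, \[ H(G;(v,u)) = \mathbf{H}(T(B)_{-0})_{f(v,u)}. \]
   Context: The graph $G$ is finite, connected and undirected, with edge set $E$. $t$-distance-regular graphs: let $E_1,\ldots,E_t$ be a partition of $E$. For a walk $\xi$ in $G$, its $t$-length is the vector in $\mathbb{N}^t$ whose $i$-th entry is the number of steps of $\xi$ that use an edge of $E_i$. Let $\leq$ be a monomial order on $\mathbb{N}^t$ (a total well-order compatible with addition, e.g. the lexicographic order). The $t$-distance $d_t(v,u)$ is the minimum with respect to $\leq$ of the $t$-lengths of all walks between $u$ and $v$. $G$ is $t$-distance-regular if there exist an edge partition $\{E_i\}_{i=1}^t$ and a monomial order $\le$ on $\mathbb{N}^t$ such that for all $\mathbf{a},\mathbf{b}\in\mathbb{N}^t$ the number of vertices at $t$-distance $\mathbf{a}$ from $u$ and $t$-distance $\mathbf{b}$ from $v$ depends only on the $t$-distance between $u$ and $v$. The $t$-distance matrices of $G$ are the $0/1$ matrices,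 one for each occurring $t$-distance, with $(u,v)$-entry $1$ iff $u,v$ are at that $t$-distance; they form a symmetric association scheme, enumerated as $A_0=I,A_1,\ldots,A_d$. The function $f:V\times V\to\{0,\ldots,d\}$ is defined by $f(v,u)=j$ iff $(A_j)_{vu}=1$. The intersection numbers are written in the convention that the matrix $(p_{ij}^k)_{i,j}$ is the quotient matrix of the graph with adjacency matrix $A_k$ with respect to the partition $\{F_0(v),\ldots,F_d(v)\}$, $F_i(v)=\{u: f(v,u)=i\}$; that is, $p_{ij}^k$ is the number of $w$ with $f(v,w)=i$ and $f(u,w)=k$, for any $u$ with $f(v,u)=j$ (equivalently $A_iA_k=\sum_j p_{ij}^kA_j$). For a nonnegative square matrix $M=(m_{ij})$, $T(M)$ is the matrix with $(i,j)$-entry $m_{ij}/\sum_l m_{lj}$. $M_{-0}$ is $M$ with the row and column indexed by $0$ removed (remaining indices keep their names), and $\mathbf{H}(M)=-\mathbf{1}(M-I)^{-1}$ with $\mathbf{1}$ the all-one row vector; $\mathbf{H}(M)_x$ is its entry indexed by $x$. $H(G;(v,u))$ is the expected number of steps needed by the simple random walk on $G$ (moving to a uniformly random neighbour at each step) started at $u$ to reach $v$ for the first time. *)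

theory Defs
  imports
    "HOL-Probability.Probability"
    "Jordan_Normal_Form.Gauss_Jordan_Elimination"
    "Jordan_Normal_Form.Determinant"
begin

text \<open>
  Graphs are simple; the vertex set is the whole finite type \<^typ>\<open>'v\<close> and an edge is the
  two-element set of its ends. Two matrix libraries occur: matrices indexed by vertices are of type
  \<^typ>\<open>real^'v^'v\<close>, while those indexed by \<open>{0..d}\<close>, where \<open>d\<close> is a number
  depending on the graph, are of the type \<open>real mat\<close> with entries \<open>M $$ (i, j)\<close>.
\<close>

definition simple_graph :: "'v set set \<Rightarrow> bool" where
  "simple_graph E \<longleftrightarrow> (\<forall>e\<in>E. card e = 2)"

definition walks :: "'v set set \<Rightarrow> 'v \<Rightarrow> 'v \<Rightarrow> 'v list set" where
  "walks E v u =
     {w. w \<noteq> [] \<and> hd w = v \<and> last w = u \<and> successively (\<lambda>x y. {x, y} \<in> E) w}"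

definition connected_graph :: "'v set set \<Rightarrow> bool" where
  "connected_graph E \<longleftrightarrow> (\<forall>v u. walks E v u \<noteq> {})"

definition adjacency_matrix :: "'v::finite set set \<Rightarrow> real^'v^'v" where
  "adjacency_matrix E = (\<chi> v u. if {v, u} \<in> E then 1 else 0)"

text \<open>
  The number \<open>t\<close> is \<open>CARD('t)\<close>: the parts of the edge partition and the coordinates of
  $\mathbb{N}^t$ are indexed by the type \<^typ>\<open>'t\<close>.
\<close>

definition edge_partition :: "'v set set \<Rightarrow> ('t \<Rightarrow> 'v set set) \<Rightarrow> bool" where
  "edge_partition E P \<longleftrightarrow> inj P \<and> partition_on E (range P)"

definition t_length :: "('t::finite \<Rightarrow> 'v set set) \<Rightarrow> 'v list \<Rightarrow> nat^'t" where
  "t_length P w = (\<chi> i. card {k. Suc k < length w \<and> {w ! k, w ! Suc k} \<in> P i})"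

text \<open>The order is the relation \<open>r\<close>, with \<open>(a, b) \<in> r\<close> read as \<open>a \<le> b\<close>.\<close>

definition monomial_order :: "(nat^'t::finite) rel \<Rightarrow> bool" where
  "monomial_order r \<longleftrightarrow>
     well_order_on UNIV r \<and> (\<forall>a b c. (a, b) \<in> r \<longrightarrow> (a + c, b + c) \<in> r)"

definition t_distance ::
  "'v set set \<Rightarrow> ('t::finite \<Rightarrow> 'v set set) \<Rightarrow> (nat^'t) rel \<Rightarrow> 'v \<Rightarrow> 'v \<Rightarrow> nat^'t" where
  "t_distance E P r v u = wo_rel.minim r (t_length P ` walks E v u)"

definition t_distance_regular_wrt ::
  "'v::finite set set \<Rightarrow> ('t::finite \<Rightarrow> 'v set set) \<Rightarrow> (nat^'t) rel \<Rightarrow> bool" where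
  "t_distance_regular_wrt E P r \<longleftrightarrow>
     edge_partition E P \<and> monomial_order r \<and>
     (\<forall>a b u v u' v'. t_distance E P r u v = t_distance E P r u' v' \<longrightarrow>
        card {w. t_distance E P r u w = a \<and> t_distance E P r v w = b} =
        card {w. t_distance E P r u' w = a \<and> t_distance E P r v' w = b})"

definition t_distance_matrix ::
  "'v::finite set set \<Rightarrow> ('t::finite \<Rightarrow> 'v set set) \<Rightarrow> (nat^'t) rel \<Rightarrow> nat^'t \<Rightarrow> real^'v^'v" where
  "t_distance_matrix E P r a = (\<chi> v u. if t_distance E P r v u = a then 1 else 0)"

text \<open>\<open>A 0 = I, A 1, \<dots>, A d\<close> lists every t-distance matrix exactly once.\<close>

definition enumerates_t_distance_matrices ::
  "'v::finite set set \<Rightarrow> ('t::finite \<Rightarrow> 'v set set) \<Rightarrow> (nat^'t) rel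
     \<Rightarrow> nat \<Rightarrow> (nat \<Rightarrow> real^'v^'v) \<Rightarrow> bool" where
  "enumerates_t_distance_matrices E P r d A \<longleftrightarrow>
     A 0 = Finite_Cartesian_Product.mat 1 \<and>
     bij_betw A {0..d} {t_distance_matrix E P r (t_distance E P r v u) | v u. True}"

definition class_index :: "nat \<Rightarrow> (nat \<Rightarrow> real^'v^'v) \<Rightarrow> 'v \<Rightarrow> 'v \<Rightarrow> nat" where
  "class_index d A v u = (THE j. j \<le> d \<and> A j $ v $ u = 1)"

text \<open>
  The number written $p_{ij}^k$, as an entry of the quotient matrix of $A_k$: the common number of
  \<open>w\<close> for all pairs \<open>v\<close>, \<open>u\<close> in class \<open>j\<close>. Note that \<open>j\<close>, not \<open>k\<close>, is the class of
  the pair, as in $A_i A_k = \sum_j p_{ij}^k A_j$.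
\<close>

definition intersection_number ::
  "nat \<Rightarrow> (nat \<Rightarrow> real^'v^'v) \<Rightarrow> nat \<Rightarrow> nat \<Rightarrow> nat \<Rightarrow> nat" where
  "intersection_number d A i j k =
     (THE n. \<forall>v u. class_index d A v u = j \<longrightarrow>
        card {w. class_index d A v w = i \<and> class_index d A u w = k} = n)"

definition B_matrix ::
  "nat \<Rightarrow> (nat \<Rightarrow> real^'v^'v) \<Rightarrow> ('t::finite \<Rightarrow> nat) \<Rightarrow> real mat" where
  "B_matrix d A e =
     Matrix.mat (d + 1) (d + 1) (\<lambda>(i, j). \<Sum>x\<in>UNIV. real (intersection_number d A i j (e x)))"

definition T_matrix :: "real mat \<Rightarrow> real mat" where
  "T_matrix M = Matrix.mat (dim_row M) (dim_col M)
     (\<lambda>(i, j). M $$ (i, j) / (\<Sum>l<dim_row M. M $$ (l, j)))"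

abbreviation minus0 :: "'a mat \<Rightarrow> 'a mat" where
  "minus0 M \<equiv> mat_delete M 0 0"

text \<open>
  \<open>H_entry M x\<close> is the entry with index \<open>x \<in> {1..d}\<close> of the row vector
  $-\mathbf{1}(M-I)^{-1}$, for a matrix \<open>M\<close> with rows and columns indexed by \<open>{1..d}\<close> (as
  \<^term>\<open>minus0\<close> yields); the positions of a \<open>mat\<close> start at 0, hence the shift.
\<close>

definition H_entry :: "real mat \<Rightarrow> nat \<Rightarrow> real" where
  "H_entry M x =
     (let n = dim_row M
      in (- (Matrix.mat 1 n (\<lambda>_. 1) * the (mat_inverse (M - 1\<^sub>m n)))) $$ (0, x - 1))"

definition neighbours :: "'v set set \<Rightarrow> 'v \<Rightarrow> 'v set" where
  "neighbours E x = {y. {x, y} \<in> E}"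

text \<open>
  The walk is driven by a sequence of independent random maps \<open>c !! 0, c !! 1, \<dots>\<close>: the values of
  each map are independent, and the value at \<open>x\<close> is a uniformly random neighbour of \<open>x\<close>.
  From \<open>x\<close> the walk moves at step \<open>n\<close> to \<open>(c !! n) x\<close>, hence, independently of its past, to a
  uniformly random neighbour.
\<close>

definition walk_space :: "'v::finite set set \<Rightarrow> ('v \<Rightarrow> 'v) stream measure" where
  "walk_space E =
     stream_space (measure_pmf (Pi_pmf UNIV undefined (\<lambda>x. pmf_of_set (neighbours E x))))"

primrec random_walk :: "'v \<Rightarrow> ('v \<Rightarrow> 'v) stream \<Rightarrow> nat \<Rightarrow> 'v" where
  "random_walk u c 0 = u"
| "random_walk u c (Suc n) = (c !! n) (random_walk u c n)"

text \<open>\<open>\<infinity>\<close> if \<open>v\<close> is never reached.\<close>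

definition first_hit :: "'v \<Rightarrow> 'v \<Rightarrow> ('v \<Rightarrow> 'v) stream \<Rightarrow> ennreal" where
  "first_hit v u c = (INF n\<in>{n. random_walk u c n = v}. of_nat n)"

definition expected_hitting_time :: "'v::finite set set \<Rightarrow> 'v \<times> 'v \<Rightarrow> ennreal" where
  "expected_hitting_time E = (\<lambda>(v, u). \<integral>\<^sup>+ c. first_hit v u c \<partial>walk_space E)"

end

theory Submission
  imports Defs
begin

text \<open>
  Fix the target \<open>v\<close>. Two facts about the vertex graph carry the proof.

  First, the expected hitting times of \<open>v\<close> are characterised by first-step analysis: they are the
  only real function \<open>g\<close> with \<open>g v = 0\<close> and \<open>g x = 1 +\<close> (average of \<open>g\<close> over the
  neighbours of \<open>x\<close>) for \<open>x \<noteq> v\<close> (\<open>expected_hitting_time_eqI\<close>). Uniqueness is the maximum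
  principle: on a connected graph, a function that vanishes at \<open>v\<close> and equals its neighbour
  average elsewhere is zero (\<open>harmonic_eq_0\<close>).

  Second, the partition of the vertices by their class relative to \<open>v\<close> is equitable. The entry
  \<open>q i j\<close> of \<open>B\<close> counts the neighbours in class \<open>i\<close> of any vertex in class \<open>j\<close>, because
  the adjacency matrix is the sum of the matrices \<open>A (e x)\<close>; column \<open>j\<close> of \<open>B\<close> hence sums to
  the degree of such a vertex, and \<open>T(B)\<close> holds the transition probabilities between classes. So
  for a row vector \<open>y\<close>, extended by \<open>0\<close> at index \<open>0\<close>, entry \<open>j\<close> of the product of
  \<open>y\<close> with \<open>T(B)\<close>, row and column \<open>0\<close> removed, is the neighbour average, at any vertex in
  class \<open>j\<close>, of the function taking the value \<open>y i\<close> on class \<open>i\<close>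
  (\<open>nbr_average_class_function\<close>).

  Under this correspondence a row vector in the left kernel of \<open>T(B)\<^sub>-\<^sub>0 - I\<close> becomes a harmonic
  function vanishing at \<open>v\<close>, so the kernel is trivial and the inverse exists
  (\<open>minus0_T_B_matrix_kernel\<close>), while the defining equation of \<open>\<^bold>H\<close> becomes the first-step
  equation for the hitting times (\<open>expected_hitting_time_eq_H_entry\<close>).
\<close>

section \<open>Functions compared with their averages over neighbours\<close>

definition nbr_average :: "'v::finite set set \<Rightarrow> ('v \<Rightarrow> real) \<Rightarrow> 'v \<Rightarrow> real" where
  "nbr_average E g x = (\<Sum>y\<in>neighbours E x. g y) / real (card (neighbours E x))"

lemma nbr_average_diff:
  "nbr_average E (\<lambda>x. g x - h x) x = nbr_average E g x - nbr_average E h x"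
  by (simp add: nbr_average_def sum_subtractf diff_divide_distrib)

lemma nbr_average_uminus: "nbr_average E (\<lambda>x. - g x) x = - nbr_average E g x"
  by (simp add: nbr_average_def sum_negf)

lemma neighbours_nonempty:
  assumes "connected_graph E" and "x \<noteq> v"
  shows "neighbours E x \<noteq> {}"
proof -
  obtain w where w: "w \<noteq> []" "hd w = x" "last w = v" "successively (\<lambda>x y. {x, y} \<in> E) w"
    using assms(1) unfolding connected_graph_def walks_def by blast
  with assms(2) obtain y z where "w = x # y # z"
    by (cases w rule: remdups_adj.cases) auto
  with w have "{x, y} \<in> E" by simp
  then show ?thesis by (auto simp: neighbours_def)
qed

lemma connected_closed_set:
  assumes "connected_graph E" and "x \<in> S"
    and closed: "\<And>y z. y \<in> S \<Longrightarrow> {y, z} \<in> E \<Longrightarrow> z \<in> S"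
  shows "v \<in> S"
proof -
  obtain w where "w \<noteq> []" "hd w = x" "last w = v" "successively (\<lambda>x y. {x, y} \<in> E) w"
    using assms(1) unfolding connected_graph_def walks_def by blast
  with \<open>x \<in> S\<close> show ?thesis
  proof (induction w arbitrary: x)
    case (Cons a w)
    then show ?case
      by (cases w) (use closed in auto)
  qed simp
qed

text \<open>
  The set where the maximum is attained is closed under taking neighbours as long as it avoids
  \<open>v\<close>, since an average of values at most \<open>m\<close> equals \<open>m\<close> only if all of them do. If the
  maximum were positive, connectedness would bring \<open>v\<close> into that set. The one-sided hypothesis
  lets the same lemma give both uniqueness and nonnegativity of solutions of the first-step equation.
\<close>

lemma maximum_principle:
  fixes g :: "'v::finite \<Rightarrow> real"
  assumes conn: "connected_graph E" and gv: "g v \<le> 0"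
    and sub: "\<And>x. x \<noteq> v \<Longrightarrow> g x \<le> nbr_average E g x"
  shows "g x \<le> 0"
proof (rule ccontr)
  assume "\<not> g x \<le> 0"
  define m where "m = Max (range g)"
  have le: "g y \<le> m" for y by (simp add: m_def)
  have "m > 0" using le[of x] \<open>\<not> g x \<le> 0\<close> by simp
  have "m \<in> range g" unfolding m_def by (rule Max_in) auto
  then obtain x0 where x0: "g x0 = m" by auto
  have step: "g z = m" if "g y = m" "{y, z} \<in> E" for y z
  proof (rule ccontr)
    assume "g z \<noteq> m"
    with le[of z] have lt: "g z < m" by simp
    have z: "z \<in> neighbours E y" using that by (simp add: neighbours_def)
    then have card: "card (neighbours E y) > 0" by (auto simp: card_gt_0_iff)
    have "y \<noteq> v" using gv \<open>m > 0\<close> that by auto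
    have "(\<Sum>y\<in>neighbours E y. g y) < (\<Sum>y\<in>neighbours E y. m)"
      by (rule sum_strict_mono_ex1) (use z lt le in auto)
    also have "\<dots> = real (card (neighbours E y)) * m" by simp
    finally have "nbr_average E g y < m"
      using card by (simp add: nbr_average_def field_simps)
    with sub[OF \<open>y \<noteq> v\<close>] that show False by simp
  qed
  have "v \<in> {y. g y = m}"
    by (rule connected_closed_set[OF conn, of x0]) (use x0 step in auto)
  with gv \<open>m > 0\<close> show False by simp
qed

lemma harmonic_eq_0:
  fixes g :: "'v::finite \<Rightarrow> real"
  assumes "connected_graph E" and "g v = 0"
    and "\<And>x. x \<noteq> v \<Longrightarrow> g x = nbr_average E g x"
  shows "g x = 0"
proof -
  have "g x \<le> 0"
    by (rule maximum_principle[OF assms(1), where v = v]) (use assms(2,3) in auto)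
  moreover have "- g x \<le> 0"
    by (rule maximum_principle[OF assms(1), where v = v])
      (use assms(2,3) in \<open>auto simp: nbr_average_uminus\<close>)
  ultimately show ?thesis by simp
qed

section \<open>First-step analysis of the random walk\<close>

lemma measurable_random_walk [measurable]:
  fixes E :: "'v::finite set set"
  shows "(\<lambda>c. random_walk x c n) \<in> measurable (walk_space E) (count_space UNIV)"
proof (induction n)
  case (Suc n)
  have snth: "(\<lambda>c. c !! n) \<in> measurable (walk_space E) (count_space UNIV)"
    unfolding walk_space_def
    using measurable_snth[of n "measure_pmf (Pi_pmf UNIV undefined (\<lambda>x. pmf_of_set (neighbours E x)))"]
    by (simp cong: measurable_cong_sets)
  show ?case
    unfolding random_walk.simps
    by (rule measurable_compose_countable'[OF _ Suc])
      (auto intro: measurable_compose[OF snth])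
qed simp

lemma first_hit_altdef:
  "first_hit v x c = (INF n. if random_walk x c n = v then of_nat n else \<top>)"
  unfolding first_hit_def
proof (rule antisym)
  show "(INF n. if random_walk x c n = v then of_nat n else \<top>) \<le>
      (INF n\<in>{n. random_walk x c n = v}. of_nat n :: ennreal)"
    by (rule INF_mono) auto
qed (rule INF_greatest, simp add: INF_lower)

lemma measurable_first_hit [measurable]:
  fixes E :: "'v::finite set set"
  shows "first_hit v x \<in> borel_measurable (walk_space E)"
  unfolding first_hit_altdef[abs_def] by measurable

lemma first_hit_self: "first_hit v v c = 0"
  proof -
  have "first_hit v v c \<le> of_nat 0" unfolding first_hit_def by (rule INF_lower) simp
  then show ?thesis by simp
qed

lemma random_walk_Stream: "random_walk x (f ## c) (Suc n) = random_walk (f x) c n"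
  by (induction n) auto

text \<open>
  Conditioning on the first random map: after one step the walk starts afresh from \<open>f x\<close>, driven
  by the remaining stream.
\<close>

lemma first_hit_Stream:
  assumes "x \<noteq> v"
  shows "first_hit v x (f ## c) = 1 + first_hit v (f x) c"
proof -
  have "n \<in> {n. random_walk x (f ## c) n = v} \<longleftrightarrow>
      n \<in> Suc ` {n. random_walk (f x) c n = v}" for n
    using assms by (cases n) (auto simp: random_walk_Stream simp del: random_walk.simps(2))
  then have *: "{n. random_walk x (f ## c) n = v} = Suc ` {n. random_walk (f x) c n = v}"
    by (rule Set.set_eqI)
  have "first_hit v x (f ## c) = (INF n\<in>{n. random_walk (f x) c n = v}. 1 + of_nat n)"
    unfolding first_hit_def * by (simp add: image_comp o_def)
  also have "\<dots> = (INF n. 1 + (if random_walk (f x) c n = v then of_nat n else \<top>))"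
  proof (rule antisym)
    show "(INF n. 1 + (if random_walk (f x) c n = v then of_nat n else \<top>)) \<le>
        (INF n\<in>{n. random_walk (f x) c n = v}. 1 + of_nat n :: ennreal)"
      by (rule INF_mono) auto
  qed (rule INF_greatest, auto intro: INF_lower)
  also have "\<dots> = 1 + first_hit v (f x) c"
    unfolding first_hit_altdef by (rule INF_ennreal_const_add)
  finally show ?thesis .
qed

lemma prob_space_walk_space: "prob_space (walk_space E)"
  unfolding walk_space_def by (rule prob_space.prob_space_stream_space) (rule prob_space_measure_pmf)

text \<open>
  The truncation level \<open>K\<close> serves two purposes: with finite \<open>K\<close> the first-step equation lowers
  \<open>K\<close> by one, which permits induction before the expectation is known to be finite, and with
  \<open>K = \<top>\<close> it is the equation for the expected hitting time itself.
\<close>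

definition truncated_hitting_time ::
  "'v::finite set set \<Rightarrow> 'v \<Rightarrow> ennreal \<Rightarrow> 'v \<Rightarrow> ennreal" where
  "truncated_hitting_time E v K x = (\<integral>\<^sup>+ c. min (first_hit v x c) K \<partial>walk_space E)"

lemma truncated_hitting_time_top:
  "truncated_hitting_time E v \<top> x = expected_hitting_time E (v, x)"
  by (simp add: truncated_hitting_time_def expected_hitting_time_def)

lemma truncated_hitting_time_first_step:
  fixes E :: "'v::finite set set"
  assumes "x \<noteq> v" and ne: "neighbours E x \<noteq> {}"
  shows "truncated_hitting_time E v (1 + K) x =
    1 + (\<Sum>y\<in>neighbours E x. truncated_hitting_time E v K y) / of_nat (card (neighbours E x))"
proof -
  define p where "p = Pi_pmf UNIV undefined (\<lambda>x. pmf_of_set (neighbours E x))"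
  have ws: "walk_space E = stream_space (measure_pmf p)"
    by (simp add: walk_space_def p_def)
  interpret prob_space "walk_space E" by (rule prob_space_walk_space)
  have min_add: "min (1 + t) (1 + K) = 1 + min t K" for t :: ennreal
    by (auto simp: min_def)
  have "truncated_hitting_time E v (1 + K) x =
      (\<integral>\<^sup>+ f. \<integral>\<^sup>+ c. min (first_hit v x (f ## c)) (1 + K) \<partial>walk_space E \<partial>p)"
    unfolding truncated_hitting_time_def ws
    by (rule prob_space.nn_integral_stream_space[OF prob_space_measure_pmf])
      (use measurable_first_hit[of v x E, unfolded ws] in measurable)
  also have "\<dots> = (\<integral>\<^sup>+ f. \<integral>\<^sup>+ c. 1 + min (first_hit v (f x) c) K \<partial>walk_space E \<partial>p)"
    using assms(1) by (simp add: first_hit_Stream min_add)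
  also have "\<dots> = (\<integral>\<^sup>+ f. 1 + truncated_hitting_time E v K (f x) \<partial>p)"
    unfolding truncated_hitting_time_def
    by (subst nn_integral_add) (auto simp: emeasure_space_1)
  also have "\<dots> = 1 + (\<integral>\<^sup>+ f. truncated_hitting_time E v K (f x) \<partial>p)"
    by (subst nn_integral_add) auto
  also have "(\<integral>\<^sup>+ f. truncated_hitting_time E v K (f x) \<partial>p) =
      (\<integral>\<^sup>+ y. truncated_hitting_time E v K y \<partial>map_pmf (\<lambda>f. f x) p)"
    by simp
  also have "map_pmf (\<lambda>f. f x) p = pmf_of_set (neighbours E x)"
    unfolding p_def by (simp add: Pi_pmf_component)
  finally show ?thesis
    using ne by (simp add: nn_integral_pmf_of_set)
qed

lemma truncated_hitting_time_self: "truncated_hitting_time E v K v = 0"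
  by (simp add: truncated_hitting_time_def first_hit_self)

lemma expected_hitting_time_le:
  fixes E :: "'v::finite set set"
  assumes "\<And>n. truncated_hitting_time E v (of_nat n) x \<le> b"
  shows "expected_hitting_time E (v, x) \<le> b"
proof -
  have eq: "first_hit v x c = (SUP n. min (first_hit v x c) (of_nat n))" for c
    unfolding inf_min[symmetric] inf_SUP[symmetric] ennreal_SUP_of_nat_eq_top by simp
  have "expected_hitting_time E (v, x) =
      (\<integral>\<^sup>+ c. (SUP n. min (first_hit v x c) (of_nat n)) \<partial>walk_space E)"
    unfolding expected_hitting_time_def using eq by simp
  also have "\<dots> = (SUP n. truncated_hitting_time E v (of_nat n) x)"
    unfolding truncated_hitting_time_def
    by (rule nn_integral_monotone_convergence_SUP)
      (auto simp: incseq_def le_fun_def intro: min.coboundedI2)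
  also have "\<dots> \<le> b" by (rule SUP_least) (rule assms)
  finally show ?thesis .
qed

lemma sum_over_card_ennreal:
  assumes "\<And>y. g y \<ge> 0" and "S \<noteq> {}" and "finite S"
  shows "(\<Sum>y\<in>S. ennreal (g y)) / of_nat (card S) = ennreal ((\<Sum>y\<in>S. g y) / real (card S))"
  using assms by (simp add: ennreal_of_nat_eq_real_of_nat divide_ennreal card_gt_0_iff sum_nonneg)

text \<open>
  A nonnegative solution \<open>g\<close> bounds every truncated hitting time, by induction on the level: both
  sides obey the same recursion and \<open>g\<close> starts above \<open>0\<close>. Monotone convergence then makes the
  expected hitting time finite. It is therefore a real solution of the same equation, and
  the difference of two solutions is harmonic away from \<open>v\<close> and zero at \<open>v\<close>.
\<close>

lemma expected_hitting_time_eqI: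
  fixes E :: "'v::finite set set"
  assumes conn: "connected_graph E" and gv: "g v = 0"
    and g: "\<And>x. x \<noteq> v \<Longrightarrow> g x = 1 + nbr_average E g x"
  shows "expected_hitting_time E (v, x) = ennreal (g x)"
proof -
  have nonneg: "g x \<ge> 0" for x
  proof -
    have "- g x \<le> 0"
      by (rule maximum_principle[OF conn, where v = v])
        (use gv g in \<open>auto simp: nbr_average_uminus\<close>)
    then show ?thesis by simp
  qed
  have trunc: "truncated_hitting_time E v (of_nat n) x \<le> ennreal (g x)" for n x
  proof (induction n arbitrary: x)
    case 0
    then show ?case by (simp add: truncated_hitting_time_def)
  next
    case (Suc n)
    show ?case
    proof (cases "x = v")
      case True
      then show ?thesis by (simp add: truncated_hitting_time_self)
    next
      case False
      note ne = neighbours_nonempty[OF conn False]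
      have "truncated_hitting_time E v (of_nat (Suc n)) x \<le>
          1 + (\<Sum>y\<in>neighbours E x. ennreal (g y)) / of_nat (card (neighbours E x))"
        unfolding of_nat_Suc truncated_hitting_time_first_step[OF False ne]
        by (intro add_left_mono divide_right_mono_ennreal sum_mono Suc.IH)
      also have "\<dots> = ennreal (1 + nbr_average E g x)"
        using nonneg ne
        by (simp add: sum_over_card_ennreal nbr_average_def sum_nonneg del: sum_ennreal flip: ennreal_1)
      finally show ?thesis using g[OF False] by simp
    qed
  qed
  define k where "k x = enn2real (expected_hitting_time E (v, x))" for x
  have k: "expected_hitting_time E (v, x) = ennreal (k x)" for x
    unfolding k_def using expected_hitting_time_le[OF trunc, of x]
    by (intro ennreal_enn2real[symmetric]) (auto simp: top_unique less_top[symmetric])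
  have k_nonneg: "k x \<ge> 0" for x by (simp add: k_def)
  have kv: "k v = 0"
    using truncated_hitting_time_self[of E v \<top>]
    by (simp add: truncated_hitting_time_top k_def)
  have k_step: "k x = 1 + nbr_average E k x" if "x \<noteq> v" for x
  proof -
    note ne = neighbours_nonempty[OF conn that]
    have "ennreal (k x) = ennreal (1 + nbr_average E k x)"
      using truncated_hitting_time_first_step[OF that ne, of \<top>] k_nonneg ne
      by (simp add: truncated_hitting_time_top k sum_over_card_ennreal nbr_average_def
          sum_nonneg del: sum_ennreal flip: ennreal_1)
    moreover have "nbr_average E k x \<ge> 0" using k_nonneg by (simp add: nbr_average_def sum_nonneg)
    ultimately show ?thesis using k_nonneg by (subst (asm) ennreal_inj) auto
  qed
  have "g x - k x = 0"
    by (rule harmonic_eq_0[OF conn, where v = v])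
      (use gv kv g k_step in \<open>auto simp: nbr_average_diff\<close>)
  then show ?thesis by (simp add: k)
qed

section \<open>The row vector defined by the inverse matrix\<close>

text \<open>
  A trivial left kernel of \<open>M - I\<close> makes it invertible, and multiplying \<open>h = -\<^bold>1(M - I)\<^sup>-\<^sup>1\<close>
  by \<open>M - I\<close> gives \<open>h = \<^bold>1 + h M\<close>. In coordinates this has the form of the first-step equation.
\<close>

lemma row_vector_fixed_point:
  assumes M: "M \<in> carrier_mat d d"
    and ker: "\<And>y. (\<And>j. j < d \<Longrightarrow> y j = (\<Sum>i<d. y i * M $$ (i, j))) \<Longrightarrow> \<forall>j<d. y j = 0"
  shows "invertible_mat (M - 1\<^sub>m d)"
    and "\<And>j. j < d \<Longrightarrow> H_entry M (Suc j) = 1 + (\<Sum>i<d. H_entry M (Suc i) * M $$ (i, j))"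
proof -
  define K where "K = M - 1\<^sub>m d"
  have K: "K \<in> carrier_mat d d" unfolding K_def by (intro minus_carrier_mat) simp
  have row: "(\<Sum>i<d. y i * K $$ (i, j)) = (\<Sum>i<d. y i * M $$ (i, j)) - y j" if "j < d" for y j
  proof -
    have "(\<Sum>i<d. y i * K $$ (i, j)) = (\<Sum>i<d. y i * M $$ (i, j) - (if i = j then y i else 0))"
      using that M by (intro sum.cong) (auto simp: K_def algebra_simps)
    then show ?thesis using that by (simp add: sum_subtractf)
  qed
  have "Determinant.det K \<noteq> 0"
  proof
    assume "Determinant.det K = 0"
    then have "Determinant.det (transpose_mat K) = 0" using det_transpose[OF K] by simp
    then obtain y where y: "y \<in> carrier_vec d" "y \<noteq> 0\<^sub>v d" "transpose_mat K *\<^sub>v y = 0\<^sub>v d"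
      using det_0_iff_vec_prod_zero[of "transpose_mat K" d] K by auto
    have "\<forall>j<d. vec_index y j = 0"
    proof (rule ker)
      fix j assume j: "j < d"
      have "0 = vec_index (transpose_mat K *\<^sub>v y) j" using y j by simp
      also have "\<dots> = (\<Sum>i<d. vec_index y i * K $$ (i, j))"
        using j K y(1) by (simp add: scalar_prod_def lessThan_atLeast0 mult.commute)
      finally show "vec_index y j = (\<Sum>i<d. vec_index y i * M $$ (i, j))"
        using row[OF j] by simp
    qed
    then have "y = 0\<^sub>v d" using y(1) by (intro eq_vecI) auto
    with y(2) show False by simp
  qed
  then have "K \<in> Units (ring_mat TYPE(real) d ())" by (rule det_non_zero_imp_unit[OF K])
  then obtain C where C: "mat_inverse K = Some C"
    using mat_inverse(1)[OF K, of "()"] by (cases "mat_inverse K") auto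
  from mat_inverse(2)[OF K C] have CK: "K * C = 1\<^sub>m d" "C * K = 1\<^sub>m d" "C \<in> carrier_mat d d"
    by auto
  show "invertible_mat (M - 1\<^sub>m d)"
    unfolding K_def[symmetric] invertible_mat_def inverts_mat_def square_mat.simps
    using CK K by auto
  define R where "R = Matrix.mat 1 d (\<lambda>_. 1::real)"
  have R: "R \<in> carrier_mat 1 d" by (simp add: R_def)
  define h where "h = - (R * C)"
  have h: "h \<in> carrier_mat 1 d" using R CK by (simp add: h_def)
  have H: "H_entry M (Suc j) = h $$ (0, j)" for j
    using M by (simp add: H_entry_def Let_def K_def[symmetric] C h_def R_def)
  have "h * K = - (R * C * K)" unfolding h_def using R CK K by simp
  also have "R * C * K = R" using R CK K by (simp add: assoc_mult_mat[of R 1 d C d K d])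
  finally have hK: "h * K = - R" .
  fix j assume j: "j < d"
  have "(h * K) $$ (0, j) = (\<Sum>i<d. h $$ (0, i) * K $$ (i, j))"
    using j h K by (simp add: scalar_prod_def lessThan_atLeast0)
  moreover have "(h * K) $$ (0, j) = -1" unfolding hK using j by (simp add: R_def)
  ultimately show "H_entry M (Suc j) = 1 + (\<Sum>i<d. H_entry M (Suc i) * M $$ (i, j))"
    unfolding H using row[OF j, of "\<lambda>i. h $$ (0, i)"] by simp
qed

section \<open>Classes of vertex pairs and the quotient matrix\<close>

context
  fixes E :: "'v::finite set set" and P :: "'t::finite \<Rightarrow> 'v set set" and r :: "(nat^'t) rel"
    and d :: nat and A :: "nat \<Rightarrow> real^'v^'v"
  assumes enum: "enumerates_t_distance_matrices E P r d A"
begin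

lemma t_distance_matrix_of_class:
  assumes "j \<le> d"
  obtains v u where "A j = t_distance_matrix E P r (t_distance E P r v u)"
proof -
  have "A j \<in> A ` {0..d}" using assms by simp
  also have "A ` {0..d} = {t_distance_matrix E P r (t_distance E P r v u) | v u. True}"
    using enum unfolding enumerates_t_distance_matrices_def bij_betw_def by blast
  finally show ?thesis using that by blast
qed

lemma class_matrix_entry:
  assumes "j \<le> d"
  shows "A j $ v $ u =
    (if A j = t_distance_matrix E P r (t_distance E P r v u) then 1 else 0)"
proof -
  obtain v' u' where j: "A j = t_distance_matrix E P r (t_distance E P r v' u')"
    using t_distance_matrix_of_class[OF assms] .
  have entry: "t_distance_matrix E P r a $ v $ u = (if t_distance E P r v u = a then 1 else 0)" for a
    by (simp add: t_distance_matrix_def)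
  show ?thesis
    unfolding j using entry by (metis (no_types, lifting))
qed

lemma class_index_eq_iff:
  "class_index d A v u = j \<longleftrightarrow> j \<le> d \<and> A j = t_distance_matrix E P r (t_distance E P r v u)"
proof -
  let ?D = "t_distance E P r" and ?T = "t_distance_matrix E P r"
  have entry: "A j $ v $ u = 1 \<longleftrightarrow> A j = ?T (?D v u)" if "j \<le> d" for j
    using class_matrix_entry[OF that, of v u] by simp
  have inj: "inj_on A {0..d}" and im: "A ` {0..d} = {?T (?D v u) | v u. True}"
    using enum unfolding enumerates_t_distance_matrices_def bij_betw_def by blast+
  have "?T (?D v u) \<in> A ` {0..d}" unfolding im by blast
  then obtain i where i: "i \<le> d" "A i = ?T (?D v u)" by auto
  have uniq: "j = i" if "j \<le> d" "A j = ?T (?D v u)" for j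
    using inj_onD[OF inj, of j i] that i by simp
  have "class_index d A v u = i"
    unfolding class_index_def using i uniq entry by (intro the_equality) blast+
  then show ?thesis using i uniq by blast
qed

lemma class_index_le: "class_index d A v u \<le> d"
  using class_index_eq_iff by blast

lemma class_index_eq_entry_iff:
  assumes "j \<le> d"
  shows "A j $ v $ u = (if class_index d A v u = j then 1 else 0)"
  using assms by (simp add: class_matrix_entry class_index_eq_iff)

text \<open>
  Equality of classes and equality of $t$-distances are interchangeable; this transfers the
  regularity hypothesis, stated for $t$-distances, to the classes.
\<close>

lemma class_index_same_iff:
  "class_index d A v u = class_index d A v' u' \<longleftrightarrow> t_distance E P r v u = t_distance E P r v' u'"
proof
  assume "class_index d A v u = class_index d A v' u'"
  then have "t_distance_matrix E P r (t_distance E P r v u) =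
      t_distance_matrix E P r (t_distance E P r v' u')"
    using class_index_eq_iff by metis
  then have "t_distance_matrix E P r (t_distance E P r v u) $ v $ u =
      t_distance_matrix E P r (t_distance E P r v' u') $ v $ u" by simp
  then show "t_distance E P r v u = t_distance E P r v' u'"
    by (auto simp: t_distance_matrix_def split: if_splits)
next
  assume "t_distance E P r v u = t_distance E P r v' u'"
  then show "class_index d A v u = class_index d A v' u'"
    using class_index_eq_iff by metis
qed

lemma class_index_eq_0_iff: "class_index d A v u = 0 \<longleftrightarrow> v = u"
  using class_index_eq_entry_iff[of 0 v u] enum
  by (auto simp: enumerates_t_distance_matrices_def Finite_Cartesian_Product.mat_def split: if_splits)

lemma class_index_surj:
  assumes "j \<le> d"
  obtains v u where "class_index d A v u = j"
proof -
  obtain v u where "A j = t_distance_matrix E P r (t_distance E P r v u)"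
    using t_distance_matrix_of_class[OF assms] .
  with assms have "class_index d A v u = j" by (simp add: class_index_eq_iff)
  then show ?thesis by (rule that)
qed

text \<open>
  Regularity makes the count the same for all pairs in the class of \<open>(v, u)\<close>, so the definite
  description in the definition of the intersection number denotes it.
\<close>

lemma intersection_number_eq_card:
  assumes reg: "t_distance_regular_wrt E P r" and "i \<le> d" and "k \<le> d"
  shows "intersection_number d A i (class_index d A v u) k =
    card {w. class_index d A v w = i \<and> class_index d A u w = k}"
proof -
  obtain va ua where a: "class_index d A va ua = i" using class_index_surj[OF \<open>i \<le> d\<close>] .
  obtain vb ub where b: "class_index d A vb ub = k" using class_index_surj[OF \<open>k \<le> d\<close>] .
  have *: "{w. class_index d A v w = i \<and> class_index d A u w = k} =
      {w. t_distance E P r v w = t_distance E P r va ua \<and> t_distance E P r u w = t_distance E P r vb ub}"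
    for v u
    unfolding a[symmetric] b[symmetric] class_index_same_iff ..
  have card_eq: "card {w. class_index d A v' w = i \<and> class_index d A u' w = k} =
      card {w. class_index d A v w = i \<and> class_index d A u w = k}"
    if "class_index d A v' u' = class_index d A v u" for v' u'
  proof -
    have "t_distance E P r v' u' = t_distance E P r v u"
      using that by (simp only: class_index_same_iff)
    then show ?thesis
      using reg unfolding * t_distance_regular_wrt_def by (elim conjE allE impE)
  qed
  show ?thesis
    unfolding intersection_number_def
  proof (rule the_equality)
    fix n
    assume "\<forall>v' u'. class_index d A v' u' = class_index d A v u \<longrightarrow>
      card {w. class_index d A v' w = i \<and> class_index d A u' w = k} = n"
    from this[rule_format, of v u] show "n = card {w. class_index d A v w = i \<and> class_index d A u w = k}"
      by simp
  qed (intro allI impI card_eq)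
qed

context
  fixes e :: "'t \<Rightarrow> nat"
  assumes conn: "connected_graph E" and reg: "t_distance_regular_wrt E P r"
    and e_le: "\<And>x. e x \<le> d" and adj: "adjacency_matrix E = (\<Sum>x\<in>UNIV. A (e x))"
begin

text \<open>
  Summing the indicators of \<open>A (e x)\<close> over \<open>x\<close> yields the indicator of adjacency, so the sum of
  the intersection numbers counts neighbours without regard to the part of the edge partition.
\<close>

lemma B_matrix_entry:
  assumes "i \<le> d"
  shows "B_matrix d A e $$ (i, class_index d A v u) =
    real (card {w \<in> neighbours E u. class_index d A v w = i})"
proof -
  have adj': "(\<Sum>x\<in>UNIV. if class_index d A u w = e x then 1 else 0) =
      (if w \<in> neighbours E u then 1 else 0 :: real)" for w
  proof -
    have "(\<Sum>x\<in>UNIV. if class_index d A u w = e x then 1 else 0) =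
        (\<Sum>x\<in>UNIV. vec_nth (vec_nth (A (e x)) u) w)"
      using class_index_eq_entry_iff[OF e_le] by simp
    also have "\<dots> = vec_nth (vec_nth (adjacency_matrix E) u) w"
      by (simp only: adj sum_component)
    also have "\<dots> = (if w \<in> neighbours E u then 1 else 0)"
      by (simp add: adjacency_matrix_def neighbours_def)
    finally show ?thesis .
  qed
  have card_sum: "real (card {w. Q w}) = (\<Sum>w\<in>UNIV. if Q w then 1 else 0)" for Q :: "'v \<Rightarrow> bool"
    by (simp add: sum.If_cases)
  have "B_matrix d A e $$ (i, class_index d A v u) =
      (\<Sum>x\<in>UNIV. real (card {w. class_index d A v w = i \<and> class_index d A u w = e x}))"
    using assms e_le class_index_le[of v u]
    by (simp add: B_matrix_def intersection_number_eq_card[OF reg] less_Suc_eq_le)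
  also have "\<dots> = (\<Sum>w\<in>UNIV. \<Sum>x\<in>UNIV.
      if class_index d A v w = i \<and> class_index d A u w = e x then 1 else 0)"
    unfolding card_sum by (rule sum.swap)
  also have "\<dots> = (\<Sum>w\<in>UNIV. if class_index d A v w = i then
      (\<Sum>x\<in>UNIV. if class_index d A u w = e x then 1 else 0) else 0)"
    by (intro sum.cong) auto
  also have "\<dots> = (\<Sum>w\<in>UNIV. if w \<in> neighbours E u \<and> class_index d A v w = i then 1 else 0)"
    unfolding adj' by (intro sum.cong) auto
  also have "\<dots> = real (card {w \<in> neighbours E u. class_index d A v w = i})"
    by (simp only: card_sum)
  finally show ?thesis .
qed

lemma sum_over_classes:
  "(\<Sum>i\<le>d. y i * real (card {w \<in> neighbours E u. class_index d A v w = i})) =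
    (\<Sum>w\<in>neighbours E u. y (class_index d A v w))"
proof -
  have "(\<Sum>w\<in>neighbours E u. y (class_index d A v w)) =
      (\<Sum>i\<le>d. \<Sum>w\<in>{w \<in> neighbours E u. class_index d A v w = i}. y (class_index d A v w))"
    by (rule sum.group[symmetric]) (auto simp: class_index_le)
  then show ?thesis by (simp add: mult.commute)
qed

text \<open>
  Vertices in class \<open>0\<close> contribute nothing because \<open>y 0 = 0\<close>; this is why the row with index
  \<open>0\<close> may be dropped. Positions in the reduced matrix are those of the classes \<open>1, \<dots>, d\<close>, shifted
  down by one.
\<close>

lemma nbr_average_class_function:
  assumes "y 0 = 0" and j: "class_index d A v u = Suc j"
  shows "nbr_average E (\<lambda>w. y (class_index d A v w)) u =
    (\<Sum>i<d. y (Suc i) * minus0 (T_matrix (B_matrix d A e)) $$ (i, j))"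
proof -
  have dims: "dim_row (B_matrix d A e) = Suc d" "dim_col (B_matrix d A e) = Suc d"
    by (simp_all add: B_matrix_def)
  have "Suc j \<le> d" using class_index_le[of v u] j by simp
  have B: "B_matrix d A e $$ (i, Suc j) = real (card {w \<in> neighbours E u. class_index d A v w = i})"
    if "i \<le> d" for i
    using B_matrix_entry[OF that, of v u] j by simp
  have "(\<Sum>l<Suc d. B_matrix d A e $$ (l, Suc j)) =
      (\<Sum>i\<le>d. 1 * real (card {w \<in> neighbours E u. class_index d A v w = i}))"
    by (intro sum.cong) (auto simp: B)
  also have "\<dots> = real (card (neighbours E u))"
    unfolding sum_over_classes by simp
  finally have col: "(\<Sum>l<Suc d. B_matrix d A e $$ (l, Suc j)) = real (card (neighbours E u))" .
  have "(\<Sum>i<d. y (Suc i) * minus0 (T_matrix (B_matrix d A e)) $$ (i, j)) =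
      (\<Sum>i<d. y (Suc i) * (B_matrix d A e $$ (Suc i, Suc j) / real (card (neighbours E u))))"
    using \<open>Suc j \<le> d\<close> col
    by (intro sum.cong) (simp_all add: mat_delete_def T_matrix_def dims)
  also have "\<dots> = (\<Sum>i<Suc d. y i * (B_matrix d A e $$ (i, Suc j) / real (card (neighbours E u))))"
    unfolding sum.lessThan_Suc_shift using assms(1) by simp
  also have "\<dots> = (\<Sum>i\<le>d. y i * real (card {w \<in> neighbours E u. class_index d A v w = i})) /
      real (card (neighbours E u))"
    unfolding sum_divide_distrib by (intro sum.cong) (auto simp: B)
  finally show ?thesis
    unfolding sum_over_classes nbr_average_def by simp
qed

text \<open>
  The vertex \<open>v\<close> is chosen afresh for each coordinate \<open>j\<close>, as the first vertex of some pair in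
  class \<open>j + 1\<close>; then the coordinate is a value of the harmonic function attached to \<open>v\<close>.
\<close>

lemma minus0_T_B_matrix_kernel:
  assumes y: "\<And>j. j < d \<Longrightarrow> y j = (\<Sum>i<d. y i * minus0 (T_matrix (B_matrix d A e)) $$ (i, j))"
    and "j < d"
  shows "y j = 0"
proof -
  obtain v u where vu: "class_index d A v u = Suc j"
    using class_index_surj[of "Suc j"] \<open>j < d\<close> by auto
  define y' where "y' i = (case i of 0 \<Rightarrow> 0 | Suc i \<Rightarrow> y i)" for i
  have "y' (class_index d A v u) = 0"
  proof (rule harmonic_eq_0[OF conn, where v = v])
    show "y' (class_index d A v v) = 0"
      using class_index_eq_0_iff[of v v] by (simp add: y'_def)
  next
    fix x assume "x \<noteq> v"
    then obtain k where k: "class_index d A v x = Suc k"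
      using class_index_eq_0_iff[of v x] by (cases "class_index d A v x") auto
    then have "k < d" using class_index_le[of v x] by simp
    then show "y' (class_index d A v x) = nbr_average E (\<lambda>x. y' (class_index d A v x)) x"
      using nbr_average_class_function[of y' v x k] k y[of k] by (simp add: y'_def)
  qed
  then show ?thesis by (simp add: vu y'_def)
qed

lemma expected_hitting_time_eq_H_entry:
  assumes "u \<noteq> v"
  shows "invertible_mat (minus0 (T_matrix (B_matrix d A e)) - 1\<^sub>m d)"
    and "expected_hitting_time E (v, u) =
      ennreal (H_entry (minus0 (T_matrix (B_matrix d A e))) (class_index d A v u))"
proof -
  let ?M = "minus0 (T_matrix (B_matrix d A e))"
  have M: "?M \<in> carrier_mat d d"
    by (intro carrier_matI) (simp_all add: mat_delete_def T_matrix_def B_matrix_def)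
  have ker: "\<forall>j<d. y j = 0" if "\<And>j. j < d \<Longrightarrow> y j = (\<Sum>i<d. y i * ?M $$ (i, j))" for y
    using minus0_T_B_matrix_kernel[OF that] by blast
  show "invertible_mat (?M - 1\<^sub>m d)"
    by (rule row_vector_fixed_point(1)[OF M ker])
  have H: "H_entry ?M (Suc j) = 1 + (\<Sum>i<d. H_entry ?M (Suc i) * ?M $$ (i, j))" if "j < d" for j
    by (rule row_vector_fixed_point(2)[OF M ker that])
  define g where "g i = (if i = 0 then 0 else H_entry ?M i)" for i
  have "expected_hitting_time E (v, u) = ennreal (g (class_index d A v u))"
  proof (rule expected_hitting_time_eqI[OF conn])
    show "g (class_index d A v v) = 0"
      using class_index_eq_0_iff[of v v] by (simp add: g_def)
  next
    fix x assume "x \<noteq> v"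
    then obtain k where k: "class_index d A v x = Suc k"
      using class_index_eq_0_iff[of v x] by (cases "class_index d A v x") auto
    then have "k < d" using class_index_le[of v x] by simp
    then show "g (class_index d A v x) = 1 + nbr_average E (\<lambda>x. g (class_index d A v x)) x"
      using nbr_average_class_function[of g v x k] k H[of k] by (simp add: g_def)
  qed
  (* u is not in class 0, so the value of g at its class is an entry of the row vector *)
  then show "expected_hitting_time E (v, u) = ennreal (H_entry ?M (class_index d A v u))"
    using class_index_eq_0_iff[of v u] assms by (simp add: g_def)
qed

end

end

theorem corollary4p2:
  fixes E :: "'v::finite set set"
    and P :: "'t::finite \<Rightarrow> 'v set set"
    and r :: "(nat^'t) rel"
    and d :: nat
    and A :: "nat \<Rightarrow> real^'v^'v"
    and e :: "'t \<Rightarrow> nat"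
    and u v :: 'v
  assumes "simple_graph E" and "connected_graph E"
    and "t_distance_regular_wrt E P r"
    and "enumerates_t_distance_matrices E P r d A"
    and "\<And>x. e x \<le> d"
    and "adjacency_matrix E = (\<Sum>x\<in>UNIV. A (e x))"
    and "u \<noteq> v"
  shows "invertible_mat (minus0 (T_matrix (B_matrix d A e)) - 1\<^sub>m d) \<and>
    expected_hitting_time E (v, u) =
      ennreal (H_entry (minus0 (T_matrix (B_matrix d A e))) (class_index d A v u))"
  using expected_hitting_time_eq_H_entry[OF assms(4,2,3,5,6,7)] by blast

end
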